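(* Let $K$ be the transition matrix of an irreducible aperiodic Markov chain on a finite state space $\mathcal X$ with stationary distribution $\pi$, and let $\phi$ be a transition rule for $K$ with driving variable $\mathbf U$. Let $S$ be a (nonempty) subset of $\mathcal X$ and define $\pi_0(\cdot):=\pi(\cdot\mid S)$. Consider the modified FMMR algorithm which starts in a state $\mathbf X_0$ distributed according to $\pi_0$ and outputs $W:=\mathbf X_{-T}$, where $T$ is defined to be the smallest $t$ such that all the forward trajectories from time $-t$ coalesce into $S$, i.e. such that $\mathbf Y^{(-t)}_0(x)\in S$ for every state $x\in\mathcal X$. Then $W$ has the stationary distribution $\pi$. Further, the algorithm is interruptible, i.e. $T$ and $W$ are independent random variables.
   Context: A transition rule for $K$ is a function $\phi:\mathcal X\times\mathcal U\to\mathcal X$ together with a random variable $\mathbf U$ with values in $\mathcal U$ such that $P(\phi(x,\mathbf U)=y)=K(x,y)$ for all $x,y\in\mathcal X$. Let $\tilde K$ be the time-reversal of $K$, defined by $\pi(x)K(x,y)=\pi(y)\tilde K(y,x)$ for all $x,y$. The algorithm (a modification of the FMMR, i.e. Fill–Machida–Murdoch–Rosenthal, perfect sampling algorithm) runs as follows. From the (random) initial state $\mathbf X_0$, run $\tilde K$ to obtain $\mathbf X_0,\mathbf X_{-1},\mathbf X_{-2},\dots$ in succession. Conditionally given the $\mathbf X$-values, generate $\mathbf U_0,\mathbf U_{-1},\dots$ independently, with $\mathbf U_s$ drawn from the conditional distribution of $\mathbf U$ given $\phi(\mathbf X_{s-1},\mathbf U)=\mathbf X_s$. For $t=0,1,\dots$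 and each state $x\in\mathcal X$, the forward trajectory from time $-t$ started at $x$ is defined by $\mathbf Y^{(-t)}_{-t}(x)=x$ and $\mathbf Y^{(-t)}_s(x)=\phi(\mathbf Y^{(-t)}_{s-1}(x),\mathbf U_s)$ for $-t+1\le s\le0$.
   Formalization: The formal theorem additionally assumes that T is finite almost surely; otherwise W = X_{-T} may be undefined, e.g. on {0,1} with φ(x,u) = x xor u, U a fair coin and S = {0}, where T is always infinite. *)

theory Defs
  imports "HOL-Probability.Probability" "HOL-Library.Extended_Nat"
begin

text \<open>Markov chains on a finite state space, given by the type \<open>'x\<close>. A transition matrix
  is a function \<open>K :: 'x \<Rightarrow> 'x pmf\<close>; the entry $K(x,y)$ is \<open>pmf (K x) y\<close>.\<close>

primrec nstep :: "('x \<Rightarrow> 'x pmf) \<Rightarrow> nat \<Rightarrow> 'x \<Rightarrow> 'x pmf" where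
  "nstep K 0 x = return_pmf x"
| "nstep K (Suc n) x = bind_pmf (nstep K n x) K"

definition irreducible_chain :: "('x \<Rightarrow> 'x pmf) \<Rightarrow> bool" where
  "irreducible_chain K \<longleftrightarrow> (\<forall>x y. \<exists>n. pmf (nstep K n x) y > 0)"

definition aperiodic_chain :: "('x \<Rightarrow> 'x pmf) \<Rightarrow> bool" where
  "aperiodic_chain K \<longleftrightarrow> (\<forall>x. Gcd {n. n > 0 \<and> pmf (nstep K n x) x > 0} = 1)"

definition stationary_distribution :: "('x \<Rightarrow> 'x pmf) \<Rightarrow> 'x pmf \<Rightarrow> bool" where
  "stationary_distribution K p \<longleftrightarrow> bind_pmf p K = p"

definition time_reversal :: "'x pmf \<Rightarrow> ('x \<Rightarrow> 'x pmf) \<Rightarrow> ('x \<Rightarrow> 'x pmf) \<Rightarrow> bool" where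
  "time_reversal p K K' \<longleftrightarrow> (\<forall>x y. pmf p x * pmf (K x) y = pmf p y * pmf (K' y) x)"

text \<open>The driving variable is a random variable \<open>V\<close> on a probability space \<open>P\<close>, with values
  in the measurable space \<open>E\<close>.\<close>

definition transition_rule ::
  "('x \<Rightarrow> 'x pmf) \<Rightarrow> ('x \<Rightarrow> 'u \<Rightarrow> 'x) \<Rightarrow> 'v measure \<Rightarrow> 'u measure \<Rightarrow> ('v \<Rightarrow> 'u) \<Rightarrow> bool" where
  "transition_rule K \<phi> P E V \<longleftrightarrow>
     prob_space P \<and> V \<in> measurable P E \<and>
     (\<forall>x. \<phi> x \<in> measurable E (count_space UNIV)) \<and>
     (\<forall>x y. \<P>(v in P. \<phi> x (V v) = y) = pmf (K x) y)"

text \<open>Time is indexed by \<open>n :: nat\<close> standing for the time $-n$: \<open>X n\<close> is $X_{-n}$ and \<open>U n\<close>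
  is $U_{-n}$, so \<open>U n\<close> drives the forward transition from \<open>X (Suc n)\<close> to \<open>X n\<close>.

  The last clause gives the conditional law of the driving variables given the chain. Conditioning
  on $X_0, \dots, X_{-n}$ for every \<open>n\<close> suffices to describe the conditional law given the whole
  chain: taking \<open>A i = space E\<close> for large \<open>i\<close> conditions finitely many of the \<open>U i\<close> on
  arbitrarily long initial segments of the chain.\<close>

definition fmmr_run ::
  "'x pmf \<Rightarrow> ('x \<Rightarrow> 'x pmf) \<Rightarrow> ('x \<Rightarrow> 'u \<Rightarrow> 'x) \<Rightarrow> 'v measure \<Rightarrow> 'u measure \<Rightarrow> ('v \<Rightarrow> 'u) \<Rightarrow>
   'w measure \<Rightarrow> (nat \<Rightarrow> 'w \<Rightarrow> 'x) \<Rightarrow> (nat \<Rightarrow> 'w \<Rightarrow> 'u) \<Rightarrow> bool" where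
  "fmmr_run p0 K' \<phi> P E V M X U \<longleftrightarrow>
     prob_space M \<and>
     (\<forall>n. X n \<in> measurable M (count_space UNIV)) \<and>
     (\<forall>n. U n \<in> measurable M E) \<and>
     (\<forall>n x. \<P>(w in M. \<forall>i\<le>n. X i w = x i) =
        pmf p0 (x 0) * (\<Prod>i<n. pmf (K' (x i)) (x (Suc i)))) \<and>
     (\<forall>n x A. \<P>(w in M. \<forall>i\<le>n. X i w = x i) > 0 \<longrightarrow> (\<forall>i<n. A i \<in> sets E) \<longrightarrow>
        \<P>(w in M. (\<forall>i<n. U i w \<in> A i) \<bar> (\<forall>i\<le>n. X i w = x i)) =
          (\<Prod>i<n. \<P>(v in P. V v \<in> A i \<bar> \<phi> (x (Suc i)) (V v) = x i)))"

text \<open>\<open>forward \<phi> u t x k\<close> is $Y^{(-t)}_{-t+k}(x)$, for \<open>k \<le> t\<close>.\<close>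

primrec forward :: "('x \<Rightarrow> 'u \<Rightarrow> 'x) \<Rightarrow> (nat \<Rightarrow> 'u) \<Rightarrow> nat \<Rightarrow> 'x \<Rightarrow> nat \<Rightarrow> 'x" where
  "forward \<phi> u t x 0 = x"
| "forward \<phi> u t x (Suc k) = \<phi> (forward \<phi> u t x k) (u (t - Suc k))"

definition coalesced_into :: "('x \<Rightarrow> 'u \<Rightarrow> 'x) \<Rightarrow> 'x set \<Rightarrow> (nat \<Rightarrow> 'u) \<Rightarrow> nat \<Rightarrow> bool" where
  "coalesced_into \<phi> S u t \<longleftrightarrow> (\<forall>x. forward \<phi> u t x t \<in> S)"

definition fmmr_time ::
  "('x \<Rightarrow> 'u \<Rightarrow> 'x) \<Rightarrow> 'x set \<Rightarrow> (nat \<Rightarrow> 'w \<Rightarrow> 'u) \<Rightarrow> 'w \<Rightarrow> enat" where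
  "fmmr_time \<phi> S U w =
     (if \<exists>t. coalesced_into \<phi> S (\<lambda>n. U n w) t
      then enat (LEAST t. coalesced_into \<phi> S (\<lambda>n. U n w) t) else \<infinity>)"

text \<open>Only meaningful where the running time is finite.\<close>

definition fmmr_output ::
  "('x \<Rightarrow> 'u \<Rightarrow> 'x) \<Rightarrow> 'x set \<Rightarrow> (nat \<Rightarrow> 'w \<Rightarrow> 'x) \<Rightarrow> (nat \<Rightarrow> 'w \<Rightarrow> 'u) \<Rightarrow> 'w \<Rightarrow> 'x" where
  "fmmr_output \<phi> S X U w = X (the_enat (fmmr_time \<phi> S U w)) w"

text \<open>Independence of two random variables with values in different types; the library constant
  \<open>prob_space.indep_var\<close> requires both to take values in the same type.\<close>

definition indep_rv :: "'w measure \<Rightarrow> 'a measure \<Rightarrow> ('w \<Rightarrow> 'a) \<Rightarrow> 'b measure \<Rightarrow> ('w \<Rightarrow> 'b) \<Rightarrow> bool" where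
  "indep_rv M A Y B Z \<longleftrightarrow>
     Y \<in> measurable M A \<and> Z \<in> measurable M B \<and>
     prob_space.indep_set M
       (sets (vimage_algebra (space M) Y A)) (sets (vimage_algebra (space M) Z B))"

end

(* Reversing time, the law of X_0, ..., X_(-n) and the maps phi(., U_0), ..., phi(., U_(-n+1)) is
   that of the chain started from pi at time -n and driven by independent copies of V, conditioned
   on X_0 in S. If these maps send every state into S, the conditioning event holds whatever
   X_(-n) is, so X_(-n) is still distributed as pi, independently of the maps. As T = n is
   determined by the maps and implies coalescence into S, P(T = n, X_(-n) = x) factors as
   P(T = n) pi(x). *)

theory Submission
  imports Defs
begin

section \<open>Stationary distributions and time reversal\<close>

lemma bind_nstep_stationary:
  assumes "stationary_distribution K p"
  shows "bind_pmf p (nstep K n) = p"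
proof (induction n)
  case 0
  have "nstep K 0 = return_pmf"
    by auto
  then show ?case
    by (simp add: bind_return_pmf')
next
  case (Suc n)
  have "nstep K (Suc n) = (\<lambda>x. bind_pmf (nstep K n x) K)"
    by auto
  then have "bind_pmf p (nstep K (Suc n)) = bind_pmf (bind_pmf p (nstep K n)) K"
    by (simp add: bind_assoc_pmf)
  then show ?case
    using Suc assms by (simp only: stationary_distribution_def)
qed

text \<open>Some state carries mass, irreducibility leads from it to \<open>y\<close> in
  \<open>n\<close> steps, and the \<open>n\<close>-step kernel preserves \<open>p\<close>. This
  ensures that conditioning \<open>\<pi>\<close> on a nonempty \<open>S\<close> is
  meaningful.\<close>

lemma stationary_distribution_pos:
  assumes "irreducible_chain K" "stationary_distribution K p"
  shows "pmf p y > 0"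
proof -
  obtain x where x: "x \<in> set_pmf p"
    using set_pmf_not_empty by fast
  obtain n where "pmf (nstep K n x) y > 0"
    using assms(1) unfolding irreducible_chain_def by blast
  then have "y \<in> set_pmf (nstep K n x)"
    by (simp add: set_pmf_iff)
  then have "y \<in> set_pmf (bind_pmf p (nstep K n))"
    using x by auto
  then show ?thesis
    using bind_nstep_stationary[OF assms(2)] by (simp add: pmf_positive)
qed

text \<open>Each use of the reversal identity moves the weight \<open>p\<close> from
  \<open>x n\<close> to \<open>x (Suc n)\<close> while turning one backward transition into a
  forward one.\<close>

lemma time_reversal_path:
  assumes "time_reversal p K K'"
  shows "pmf p (x 0) * (\<Prod>i<n. pmf (K' (x i)) (x (Suc i))) =
    pmf p (x n) * (\<Prod>i<n. pmf (K (x (Suc i))) (x i))"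
proof (induction n)
  case (Suc n)
  have "pmf p (x 0) * (\<Prod>i<Suc n. pmf (K' (x i)) (x (Suc i))) =
      (pmf p (x n) * pmf (K' (x n)) (x (Suc n))) * (\<Prod>i<n. pmf (K (x (Suc i))) (x i))"
    using Suc by (simp add: mult_ac)
  also have "pmf p (x n) * pmf (K' (x n)) (x (Suc n)) =
      pmf p (x (Suc n)) * pmf (K (x (Suc n))) (x n)"
    using assms by (simp add: time_reversal_def)
  finally show ?case
    by (simp add: mult_ac)
qed simp

section \<open>Forward trajectories and coalescence times\<close>

text \<open>A trajectory from time -t sees the drivers with index below \<open>t\<close>, and those
  through the maps they induce. The two sides may have drivers of different types, so a driver can
  be replaced by its map, with application as the rule.\<close>

lemma forward_cong:
  assumes "k \<le> t" "\<And>i y. i < t \<Longrightarrow> \<phi> y (u i) = \<psi> y (v i)"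
  shows "forward \<phi> u t x k = forward \<psi> v t x k"
  using assms(1) by (induction k) (auto simp: assms(2))

lemma coalesced_into_cong:
  assumes "\<And>i y. i < t \<Longrightarrow> \<phi> y (u i) = \<psi> y (v i)"
  shows "coalesced_into \<phi> S u t \<longleftrightarrow> coalesced_into \<psi> S v t"
  using forward_cong[of t t \<phi> u \<psi> v] assms by (simp add: coalesced_into_def)

lemma forward_eq_path:
  assumes "\<And>i. i < t \<Longrightarrow> x i = \<phi> (x (Suc i)) (u i)" "k \<le> t"
  shows "forward \<phi> u t (x t) k = x (t - k)"
  using assms(2)
proof (induction k)
  case (Suc k)
  then have "t - k = Suc (t - Suc k)"
    by simp
  then show ?case
    using Suc assms(1)[of "t - Suc k"] by simp
qed simp

text \<open>This expresses the event that the running time is \<open>t\<close> by drivers alone, so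
  that the congruence for coalescence carries over to it.\<close>

definition first_coalescence ::
  "('x \<Rightarrow> 'u \<Rightarrow> 'x) \<Rightarrow> 'x set \<Rightarrow> (nat \<Rightarrow> 'u) \<Rightarrow> nat \<Rightarrow> bool" where
  "first_coalescence \<phi> S u t \<longleftrightarrow>
     coalesced_into \<phi> S u t \<and> (\<forall>s<t. \<not> coalesced_into \<phi> S u s)"

lemma fmmr_time_eq_enat_iff:
  "fmmr_time \<phi> S U w = enat t \<longleftrightarrow> first_coalescence \<phi> S (\<lambda>n. U n w) t"
proof
  assume "fmmr_time \<phi> S U w = enat t"
  then show "first_coalescence \<phi> S (\<lambda>n. U n w) t"
    unfolding fmmr_time_def first_coalescence_def
    by (auto split: if_splits intro: LeastI_ex dest: not_less_Least)
next
  assume *: "first_coalescence \<phi> S (\<lambda>n. U n w) t"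
  then have "(LEAST s. coalesced_into \<phi> S (\<lambda>n. U n w) s) = t"
    unfolding first_coalescence_def by (intro Least_equality) (auto simp: not_less[symmetric])
  with * show "fmmr_time \<phi> S U w = enat t"
    unfolding fmmr_time_def first_coalescence_def by auto
qed

lemma first_coalescence_cong:
  assumes "\<And>i y. i < t \<Longrightarrow> \<phi> y (u i) = \<psi> y (v i)"
  shows "first_coalescence \<phi> S u t \<longleftrightarrow> first_coalescence \<psi> S v t"
proof -
  have "coalesced_into \<phi> S u s \<longleftrightarrow> coalesced_into \<psi> S v s" if "s \<le> t" for s
    using assms that by (intro coalesced_into_cong) auto
  then show ?thesis
    by (auto simp: first_coalescence_def)
qed

section \<open>The algorithm and its measurability\<close>

text \<open>The assumption \<open>start\<close> makes \<open>cond_pmf \<pi> S\<close> a genuine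
  conditional distribution; in the theorem it comes from irreducibility and stationarity.\<close>

locale fmmr_algorithm =
  fixes K K' :: "'x::finite \<Rightarrow> 'x pmf" and \<pi> :: "'x pmf" and S :: "'x set"
    and \<phi> :: "'x \<Rightarrow> 'u \<Rightarrow> 'x" and P :: "'v measure" and E :: "'u measure" and V :: "'v \<Rightarrow> 'u"
    and M :: "'w measure" and X :: "nat \<Rightarrow> 'w \<Rightarrow> 'x" and U :: "nat \<Rightarrow> 'w \<Rightarrow> 'u"
  assumes rule: "transition_rule K \<phi> P E V"
    and reversal: "time_reversal \<pi> K K'"
    and start: "set_pmf \<pi> \<inter> S \<noteq> {}"
    and run: "fmmr_run (cond_pmf \<pi> S) K' \<phi> P E V M X U"
begin

sublocale M: prob_space M
  using run by (simp add: fmmr_run_def)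

sublocale P: prob_space P
  using rule by (simp add: transition_rule_def)

lemma measurable_X [measurable]: "X n \<in> measurable M (count_space UNIV)"
  using run by (simp add: fmmr_run_def)

lemma measurable_U [measurable]: "U n \<in> measurable M E"
  using run by (simp add: fmmr_run_def)

lemma measurable_V [measurable]: "V \<in> measurable P E"
  using rule by (simp add: transition_rule_def)

lemma measurable_phi [measurable]: "\<phi> x \<in> measurable E (count_space UNIV)"
  using rule by (simp add: transition_rule_def)

text \<open>The rule is measurable in the driver for each fixed state; splitting over the countably
  many values of \<open>Y\<close> handles a random state.\<close>

lemma measurable_update:
  "(\<lambda>w. \<phi> (Y w) (U n w)) \<in> measurable M (count_space UNIV)"
  if "Y \<in> measurable M (count_space UNIV)"
  by (rule measurable_compose_countable[OF _ that]) measurable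

lemma measurable_forward:
  "(\<lambda>w. forward \<phi> (\<lambda>n. U n w) t x k) \<in> measurable M (count_space UNIV)"
  by (induction k) (simp_all add: measurable_update)

lemma measurable_coalesced_into [measurable]:
  "Measurable.pred M (\<lambda>w. coalesced_into \<phi> S (\<lambda>n. U n w) t)"
  unfolding coalesced_into_def
  by (intro pred_intros_countable(1) measurable_compose[OF measurable_forward]) auto

lemma measurable_first_coalescence [measurable]:
  "Measurable.pred M (\<lambda>w. first_coalescence \<phi> S (\<lambda>n. U n w) t)"
  unfolding first_coalescence_def by measurable

lemma measurable_time [measurable]: "fmmr_time \<phi> S U \<in> measurable M (count_space UNIV)"
proof -
  have "(\<lambda>w. if \<exists>t. coalesced_into \<phi> S (\<lambda>n. U n w) t
      then enat (LEAST t. coalesced_into \<phi> S (\<lambda>n. U n w) t) else \<infinity>)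
    \<in> measurable M (count_space UNIV)"
    by measurable
  then show ?thesis
    by (simp add: fmmr_time_def[abs_def])
qed

lemma measurable_output [measurable]:
  "fmmr_output \<phi> S X U \<in> measurable M (count_space UNIV)"
  unfolding fmmr_output_def[abs_def]
  by (rule measurable_compose_countable[where g = "\<lambda>w. the_enat (fmmr_time \<phi> S U w)"]) measurable

section \<open>Joint law of the chain and the drivers\<close>

text \<open>Read forwards in time, this is the law of the chain started from \<open>\<pi>\<close> at
  time -n and conditioned to end in \<open>S\<close>; the normalising constant is
  \<open>measure \<pi> S\<close>.\<close>

lemma prob_path:
  "\<P>(w in M. \<forall>i\<le>n. X i w = x i) =
    (if x 0 \<in> S then pmf \<pi> (x n) / measure \<pi> S * (\<Prod>i<n. pmf (K (x (Suc i))) (x i)) else 0)"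
proof -
  have "\<P>(w in M. \<forall>i\<le>n. X i w = x i) =
      pmf (cond_pmf \<pi> S) (x 0) * (\<Prod>i<n. pmf (K' (x i)) (x (Suc i)))"
    using run by (simp add: fmmr_run_def)
  also have "\<dots> = (if x 0 \<in> S
      then (pmf \<pi> (x 0) * (\<Prod>i<n. pmf (K' (x i)) (x (Suc i)))) / measure \<pi> S else 0)"
    by (simp add: pmf_cond[OF start])
  finally show ?thesis
    by (simp add: time_reversal_path[OF reversal])
qed

text \<open>The transition probabilities in the path law cancel the denominators of the conditional
  driver laws, leaving independent copies of \<open>V\<close> that drive the forward chain.\<close>

lemma prob_path_drivers:
  assumes A: "\<And>i. i < n \<Longrightarrow> A i \<in> sets E"
  shows "\<P>(w in M. (\<forall>i<n. U i w \<in> A i) \<and> (\<forall>i\<le>n. X i w = x i)) =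
    (if x 0 \<in> S then pmf \<pi> (x n) / measure \<pi> S *
       (\<Prod>i<n. \<P>(v in P. V v \<in> A i \<and> \<phi> (x (Suc i)) (V v) = x i)) else 0)"
proof -
  let ?path = "\<P>(w in M. \<forall>i\<le>n. X i w = x i)"
  let ?k = "\<lambda>i. pmf (K (x (Suc i))) (x i)"
  let ?j = "\<lambda>i. \<P>(v in P. V v \<in> A i \<and> \<phi> (x (Suc i)) (V v) = x i)"
  have k: "\<P>(v in P. \<phi> (x (Suc i)) (V v) = x i) = ?k i" for i
    using rule by (simp add: transition_rule_def)
  show ?thesis
  proof (cases "?path > 0")
    case True
    have "\<P>(w in M. (\<forall>i<n. U i w \<in> A i) \<bar> (\<forall>i\<le>n. X i w = x i)) =
        (\<Prod>i<n. \<P>(v in P. V v \<in> A i \<bar> \<phi> (x (Suc i)) (V v) = x i))"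
      using run A True by (auto simp: fmmr_run_def)
    then have "\<P>(w in M. (\<forall>i<n. U i w \<in> A i) \<and> (\<forall>i\<le>n. X i w = x i)) =
        ?path * (\<Prod>i<n. ?j i / ?k i)"
      using True by (simp add: cond_prob_def k field_simps)
    \<comment> \<open>A path of positive probability has no vanishing transition, so the
      denominators may be cancelled.\<close>
    moreover have "x 0 \<in> S" "(\<Prod>i<n. ?k i) \<noteq> 0"
      using True unfolding prob_path by (auto split: if_splits simp del: prod_zero_iff)
    ultimately show ?thesis
      by (simp add: prob_path prod_dividef)
  next
    \<comment> \<open>The conditional law says nothing about null paths. Both sides vanish: the left
      is bounded by the path probability, and so is the right, since \<open>?j i\<close> is at most
      \<open>?k i\<close>.\<close>
    case False
    then have zero: "?path = 0"
      using measure_nonneg[of M "{w \<in> space M. \<forall>i\<le>n. X i w = x i}"] by linarith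
    have "\<P>(w in M. (\<forall>i<n. U i w \<in> A i) \<and> (\<forall>i\<le>n. X i w = x i)) \<le> ?path"
      by (intro M.finite_measure_mono) auto
    then have "\<P>(w in M. (\<forall>i<n. U i w \<in> A i) \<and> (\<forall>i\<le>n. X i w = x i)) = 0"
      using zero by (simp add: measure_le_0_iff)
    moreover have "pmf \<pi> (x n) / measure \<pi> S * (\<Prod>i<n. ?j i) = 0" if "x 0 \<in> S"
    proof -
      have "(\<Prod>i<n. ?j i) \<le> (\<Prod>i<n. ?k i)"
        unfolding k[symmetric] using A
        by (intro prod_mono conjI P.finite_measure_mono) auto
      then have "pmf \<pi> (x n) / measure \<pi> S * (\<Prod>i<n. ?j i) \<le> ?path"
        using that by (simp add: prob_path mult_left_mono divide_right_mono)
      moreover have "0 \<le> pmf \<pi> (x n) / measure \<pi> S * (\<Prod>i<n. ?j i)"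
        by (simp add: prod_nonneg)
      ultimately show ?thesis
        using zero by linarith
    qed
    ultimately show ?thesis
      by auto
  qed
qed

text \<open>Drivers are drawn given that they reproduce the chain, so a driver contradicting it
  contributes a zero factor to the joint law.\<close>

lemma AE_update: "AE w in M. X n w = \<phi> (X (Suc n) w) (U n w)"
proof -
  have "AE w in M. X (Suc n) w = x (Suc n) \<longrightarrow>
      (\<forall>i\<le>Suc n. X i w = x i) \<longrightarrow> \<phi> (x (Suc n)) (U n w) = x n" for x
  proof -
    \<comment> \<open>Only the driver at index \<open>n\<close> is constrained, to the values that
      miss \<open>x n\<close>; its factor is then the probability of a contradiction.\<close>
    define A where "A i = (if i = n then {u \<in> space E. \<phi> (x (Suc n)) u \<noteq> x n} else space E)" for i
    have A: "A i \<in> sets E" for i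
      unfolding A_def by simp
    have "\<P>(v in P. V v \<in> A n \<and> \<phi> (x (Suc n)) (V v) = x n) = 0"
      by (simp add: A_def)
    then have "\<P>(w in M. (\<forall>i<Suc n. U i w \<in> A i) \<and> (\<forall>i\<le>Suc n. X i w = x i)) = 0"
      using prob_path_drivers[where n = "Suc n" and x = x and A = A] A by simp
    then have "AE w in M. \<not> ((\<forall>i<Suc n. U i w \<in> A i) \<and> (\<forall>i\<le>Suc n. X i w = x i))"
      using A by (subst (asm) M.prob_eq_0) auto
    then show ?thesis
      by (rule AE_mp) (rule AE_I2,
        auto simp: A_def less_Suc_eq intro: measurable_space[OF measurable_U])
  qed
  \<comment> \<open>Restricting paths to the indices up to \<open>Suc n\<close> leaves finitely many
    of them, so the exceptional null sets can be united.\<close>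
  then have "AE w in M. \<forall>x\<in>PiE {..Suc n} (\<lambda>_. UNIV). X (Suc n) w = x (Suc n) \<longrightarrow>
      (\<forall>i\<le>Suc n. X i w = x i) \<longrightarrow> \<phi> (x (Suc n)) (U n w) = x n"
    by (intro AE_finite_allI finite_PiE) auto
  then show ?thesis
  proof (rule AE_mp, intro AE_I2 impI)
    fix w assume *: "\<forall>x\<in>PiE {..Suc n} (\<lambda>_. UNIV). X (Suc n) w = x (Suc n) \<longrightarrow>
      (\<forall>i\<le>Suc n. X i w = x i) \<longrightarrow> \<phi> (x (Suc n)) (U n w) = x n"
    show "X n w = \<phi> (X (Suc n) w) (U n w)"
      using *[THEN bspec, of "restrict (\<lambda>i. X i w) {..Suc n}"] by simp
  qed
qed

text \<open>Coalescence puts the end of the path in \<open>S\<close> for every \<open>x\<close>, so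
  the indicator from the conditioning is 1 and \<open>x\<close> enters only through
  \<open>pmf \<pi> x\<close>. This is the source of both stationarity and independence.\<close>

lemma prob_drivers_coalesced:
  assumes f: "coalesced_into (\<lambda>y g. g y) S f n"
  shows "\<P>(w in M. X n w = x \<and> (\<forall>i<n. \<forall>y. \<phi> y (U i w) = f i y)) =
    pmf \<pi> x / measure \<pi> S * (\<Prod>i<n. \<P>(v in P. \<forall>y. \<phi> y (V v) = f i y))"
proof -
  \<comment> \<open>Almost surely, the maps \<open>f\<close> and \<open>X n w = x\<close> force the whole path to be \<open>z\<close>.\<close>
  define z where "z i = forward (\<lambda>y g. g y) f n x (n - i)" for i
  have z_n: "z n = x" and z_0: "z 0 \<in> S"
    using f by (auto simp: z_def coalesced_into_def)
  have z_step: "z i = f i (z (Suc i))" if "i < n" for i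
  proof -
    have "n - i = Suc (n - Suc i)" "n - Suc (n - Suc i) = i"
      using that by auto
    then show ?thesis
      by (simp add: z_def)
  qed
  define A where "A i = {u \<in> space E. \<forall>y. \<phi> y u = f i y}" for i
  have A: "A i \<in> sets E" for i
    unfolding A_def by simp
  have "AE w in M. \<forall>i. X i w = \<phi> (X (Suc i) w) (U i w)"
    using AE_update by (simp add: AE_all_countable)
  then have "AE w in M. (X n w = x \<and> (\<forall>i<n. \<forall>y. \<phi> y (U i w) = f i y)) \<longleftrightarrow>
      ((\<forall>i<n. U i w \<in> A i) \<and> (\<forall>i\<le>n. X i w = z i))"
  proof (rule AE_mp, intro AE_I2 impI)
    fix w assume w: "w \<in> space M" and step: "\<forall>i. X i w = \<phi> (X (Suc i) w) (U i w)"
    have U: "U i w \<in> A i \<longleftrightarrow> (\<forall>y. \<phi> y (U i w) = f i y)" for i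
      using measurable_space[OF measurable_U w] by (simp add: A_def)
    have "X i w = z i" if "X n w = x" "\<forall>i<n. \<forall>y. \<phi> y (U i w) = f i y" "i \<le> n" for i
    proof -
      \<comment> \<open>The realised chain is itself the forward trajectory started from
        \<open>X n w\<close>.\<close>
      have "forward \<phi> (\<lambda>i. U i w) n (X n w) (n - i) = X (n - (n - i)) w"
        by (rule forward_eq_path[where x = "\<lambda>i. X i w"]) (use step in blast, simp)
      moreover have "forward \<phi> (\<lambda>i. U i w) n (X n w) (n - i) = z i"
        unfolding z_def that(1) using that by (intro forward_cong) auto
      ultimately show ?thesis
        using that by simp
    qed
    then show "(X n w = x \<and> (\<forall>i<n. \<forall>y. \<phi> y (U i w) = f i y)) \<longleftrightarrow>
        ((\<forall>i<n. U i w \<in> A i) \<and> (\<forall>i\<le>n. X i w = z i))"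
      unfolding U using z_n by auto
  qed
  then have "\<P>(w in M. X n w = x \<and> (\<forall>i<n. \<forall>y. \<phi> y (U i w) = f i y)) =
      \<P>(w in M. (\<forall>i<n. U i w \<in> A i) \<and> (\<forall>i\<le>n. X i w = z i))"
    using A by (intro M.prob_eq_AE) auto
  also have "\<dots> = pmf \<pi> x / measure \<pi> S *
      (\<Prod>i<n. \<P>(v in P. V v \<in> A i \<and> \<phi> (z (Suc i)) (V v) = z i))"
    using prob_path_drivers[where n = n and x = z and A = A] A z_n z_0 by simp
  \<comment> \<open>By \<open>z_step\<close>, a driver inducing the map \<open>f i\<close> already
    sends \<open>z (Suc i)\<close> to \<open>z i\<close>, so the path drops out of each
    factor.\<close>
  also have "(\<Prod>i<n. \<P>(v in P. V v \<in> A i \<and> \<phi> (z (Suc i)) (V v) = z i)) =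
      (\<Prod>i<n. \<P>(v in P. \<forall>y. \<phi> y (V v) = f i y))"
    using measurable_space[OF measurable_V]
    by (intro prod.cong refl arg_cong[where f = "measure P"]) (auto simp: A_def z_step)
  finally show ?thesis .
qed

section \<open>Joint law of the running time and the output\<close>

text \<open>The event splits according to the maps induced by the first \<open>n\<close> drivers,
  and each piece factors. The constant is left unnamed here; summing over \<open>x\<close> later
  shows that it is the probability that the time is \<open>n\<close>.\<close>

lemma prob_time_state:
  "\<exists>c. \<forall>x. \<P>(w in M. fmmr_time \<phi> S U w = enat n \<and> X n w = x) = pmf \<pi> x * c"
proof -
  \<comment> \<open>Extensional tuples of self-maps of the state space: finitely many, and distinct
    ones give disjoint events.\<close>
  define D where "D = {f \<in> PiE {..<n} (\<lambda>_. UNIV :: ('x \<Rightarrow> 'x) set).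
    first_coalescence (\<lambda>y g. g y) S f n}"
  have D: "finite D"
    unfolding D_def by (intro finite_subset[OF _ finite_PiE[of "{..<n}" "\<lambda>_. UNIV"]]) auto
  have "\<P>(w in M. fmmr_time \<phi> S U w = enat n \<and> X n w = x) =
      pmf \<pi> x * (\<Sum>f\<in>D. (\<Prod>i<n. \<P>(v in P. \<forall>y. \<phi> y (V v) = f i y)) / measure \<pi> S)" for x
  proof -
    define B where
      "B f = {w \<in> space M. X n w = x \<and> (\<forall>i<n. \<forall>y. \<phi> y (U i w) = f i y)}" for f
    have "{w \<in> space M. fmmr_time \<phi> S U w = enat n \<and> X n w = x} = (\<Union>f\<in>D. B f)"
    proof (intro set_eqI iffI)
      fix w assume w: "w \<in> {w \<in> space M. fmmr_time \<phi> S U w = enat n \<and> X n w = x}"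
      define f where "f = (\<lambda>i\<in>{..<n}. \<lambda>y. \<phi> y (U i w))"
      have "first_coalescence \<phi> S (\<lambda>n. U n w) n"
        using w by (simp add: fmmr_time_eq_enat_iff)
      also have "?this \<longleftrightarrow> first_coalescence (\<lambda>y g. g y) S f n"
        by (rule first_coalescence_cong) (simp add: f_def)
      finally have "f \<in> D"
        by (simp add: D_def f_def)
      then show "w \<in> (\<Union>f\<in>D. B f)"
        using w by (auto simp: B_def f_def intro!: bexI[of _ f])
    next
      fix w assume "w \<in> (\<Union>f\<in>D. B f)"
      then obtain f where f: "f \<in> D" "w \<in> B f"
        by auto
      have "first_coalescence (\<lambda>y g. g y) S f n \<longleftrightarrow> first_coalescence \<phi> S (\<lambda>n. U n w) n"
        using f by (intro first_coalescence_cong) (simp add: B_def)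
      then show "w \<in> {w \<in> space M. fmmr_time \<phi> S U w = enat n \<and> X n w = x}"
        using f by (simp add: fmmr_time_eq_enat_iff B_def D_def)
    qed
    moreover have "disjoint_family_on B D"
    proof (unfold disjoint_family_on_def, intro ballI impI, rule ccontr)
      fix f g assume fg: "f \<in> D" "g \<in> D" "f \<noteq> g" "B f \<inter> B g \<noteq> {}"
      then obtain w where "w \<in> B f" "w \<in> B g"
        by auto
      then have "f i = g i" if "i < n" for i
        using that by (auto simp: B_def)
      then have "f = g"
        using fg(1,2) by (intro PiE_ext[of f "{..<n}" "\<lambda>_. UNIV" g]) (auto simp: D_def)
      with fg show False
        by simp
    qed
    moreover have "B f \<in> sets M" for f
      unfolding B_def by measurable
    ultimately have "\<P>(w in M. fmmr_time \<phi> S U w = enat n \<and> X n w = x) =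
        (\<Sum>f\<in>D. measure M (B f))"
      using D by (simp add: M.finite_measure_finite_Union image_subset_iff)
    also have "\<dots> = (\<Sum>f\<in>D. pmf \<pi> x / measure \<pi> S *
        (\<Prod>i<n. \<P>(v in P. \<forall>y. \<phi> y (V v) = f i y)))"
      unfolding B_def
      by (intro sum.cong refl prob_drivers_coalesced) (auto simp: D_def first_coalescence_def)
    finally show ?thesis
      by (simp add: sum_distrib_left)
  qed
  then show ?thesis
    by blast
qed

lemma prob_time_output_point:
  assumes "AE w in M. fmmr_time \<phi> S U w < \<infinity>"
  shows "\<P>(w in M. fmmr_time \<phi> S U w = t \<and> fmmr_output \<phi> S X U w = x) =
    \<P>(w in M. fmmr_time \<phi> S U w = t) * pmf \<pi> x"
proof (cases t)
  case (enat n)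
  obtain c where c: "\<P>(w in M. fmmr_time \<phi> S U w = enat n \<and> X n w = x) = pmf \<pi> x * c" for x
    using prob_time_state by blast
  have "\<P>(w in M. fmmr_time \<phi> S U w = enat n) =
      measure M (\<Union>x. {w \<in> space M. fmmr_time \<phi> S U w = enat n \<and> X n w = x})"
    by (intro arg_cong[where f = "measure M"]) auto
  \<comment> \<open>Summing over all states identifies \<open>c\<close>, because
    \<open>\<pi>\<close> has total mass 1.\<close>
  also have "\<dots> = (\<Sum>x\<in>UNIV. \<P>(w in M. fmmr_time \<phi> S U w = enat n \<and> X n w = x))"
    by (rule M.finite_measure_finite_Union) (auto simp: disjoint_family_on_def)
  also have "\<dots> = c"
    by (simp add: c sum_distrib_right[symmetric] sum_pmf_eq_1)
  finally have "\<P>(w in M. fmmr_time \<phi> S U w = enat n) = c" .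
  moreover have "{w \<in> space M. fmmr_time \<phi> S U w = enat n \<and> fmmr_output \<phi> S X U w = x} =
      {w \<in> space M. fmmr_time \<phi> S U w = enat n \<and> X n w = x}"
    by (auto simp: fmmr_output_def)
  ultimately show ?thesis
    by (simp add: enat c)
next
  case infinity
  \<comment> \<open>At infinite time the output is a junk value, but almost sure termination makes
    both sides zero.\<close>
  have "\<P>(w in M. fmmr_time \<phi> S U w = \<infinity>) = 0"
    using assms by (subst M.prob_eq_0) auto
  moreover have "\<P>(w in M. fmmr_time \<phi> S U w = \<infinity> \<and> fmmr_output \<phi> S X U w = x) \<le>
      \<P>(w in M. fmmr_time \<phi> S U w = \<infinity>)"
    by (intro M.finite_measure_mono) auto
  ultimately show ?thesis
    by (simp add: infinity measure_le_0_iff)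
qed

text \<open>The pointwise factorisation extends to arbitrary sets of times because
  \<open>enat\<close> is countable, and to sets of states by a finite sum.\<close>

lemma prob_time_output:
  assumes "AE w in M. fmmr_time \<phi> S U w < \<infinity>"
  shows "\<P>(w in M. fmmr_time \<phi> S U w \<in> A \<and> fmmr_output \<phi> S X U w \<in> B) =
    \<P>(w in M. fmmr_time \<phi> S U w \<in> A) * measure \<pi> B"
proof -
  have point: "\<P>(w in M. fmmr_time \<phi> S U w \<in> A \<and> fmmr_output \<phi> S X U w = x) =
    \<P>(w in M. fmmr_time \<phi> S U w \<in> A) * pmf \<pi> x" for x
  proof -
    let ?W = "{w \<in> space M. fmmr_output \<phi> S X U w = x}"
    \<comment> \<open>\<open>?N1\<close> is the law of the time restricted to the event
      \<open>?W\<close>, and \<open>?N2\<close> the law of the time scaled by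
      \<open>pmf \<pi> x\<close>. Measures on a countable space that agree on singletons are
      equal.\<close>
    let ?N1 = "distr (density M (indicator ?W)) (count_space UNIV) (fmmr_time \<phi> S U)"
    let ?N2 = "density (distr M (count_space UNIV) (fmmr_time \<phi> S U)) (\<lambda>_. ennreal (pmf \<pi> x))"
    have N1: "emeasure ?N1 C =
        \<P>(w in M. fmmr_time \<phi> S U w \<in> C \<and> fmmr_output \<phi> S X U w = x)" for C
    proof -
      have "emeasure ?N1 C = emeasure M (?W \<inter> {w \<in> space M. fmmr_time \<phi> S U w \<in> C})"
        by (simp add: emeasure_distr vimage_def emeasure_restricted Int_def conj_ac)
      then show ?thesis
        by (simp add: M.emeasure_eq_measure Int_def conj_ac)
    qed
    have N2: "emeasure ?N2 C = \<P>(w in M. fmmr_time \<phi> S U w \<in> C) * pmf \<pi> x" for C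
      by (simp add: emeasure_density_const emeasure_distr M.emeasure_eq_measure vimage_def Int_def
          conj_commute mult.commute ennreal_mult)
    have "?N1 = ?N2"
    proof (rule measure_eqI_countable[of _ UNIV])
      show "emeasure ?N1 {t} = emeasure ?N2 {t}" for t
        unfolding N1 N2 using prob_time_output_point[OF assms, of t x] by simp
    qed auto
    then have "emeasure ?N1 A = emeasure ?N2 A"
      by simp
    then show ?thesis
      unfolding N1 N2 by simp
  qed
  have "\<P>(w in M. fmmr_time \<phi> S U w \<in> A \<and> fmmr_output \<phi> S X U w \<in> B) =
      measure M (\<Union>x\<in>B. {w \<in> space M. fmmr_time \<phi> S U w \<in> A \<and> fmmr_output \<phi> S X U w = x})"
    by (intro arg_cong[where f = "measure M"]) auto
  also have "\<dots> = (\<Sum>x\<in>B. \<P>(w in M. fmmr_time \<phi> S U w \<in> A \<and> fmmr_output \<phi> S X U w = x))"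
    by (rule M.finite_measure_finite_Union) (auto simp: disjoint_family_on_def)
  also have "\<dots> = \<P>(w in M. fmmr_time \<phi> S U w \<in> A) * measure \<pi> B"
    by (simp add: point sum_distrib_left[symmetric] measure_measure_pmf_finite)
  finally show ?thesis .
qed

end

theorem theorem5p1:
  fixes K K' :: "'x::finite \<Rightarrow> 'x pmf" and \<pi> :: "'x pmf" and S :: "'x set"
    and \<phi> :: "'x \<Rightarrow> 'u \<Rightarrow> 'x" and P :: "'v measure" and E :: "'u measure" and V :: "'v \<Rightarrow> 'u"
    and M :: "'w measure" and X :: "nat \<Rightarrow> 'w \<Rightarrow> 'x" and U :: "nat \<Rightarrow> 'w \<Rightarrow> 'u"
  assumes "irreducible_chain K" and "aperiodic_chain K"
    and "stationary_distribution K \<pi>"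
    and "transition_rule K \<phi> P E V"
    and "time_reversal \<pi> K K'"
    and "S \<noteq> {}"
    and "fmmr_run (cond_pmf \<pi> S) K' \<phi> P E V M X U"
    and "AE w in M. fmmr_time \<phi> S U w < \<infinity>"
  shows "distr M (count_space UNIV) (fmmr_output \<phi> S X U) = measure_pmf \<pi> \<and>
    indep_rv M (count_space UNIV) (fmmr_time \<phi> S U)
      (count_space UNIV) (fmmr_output \<phi> S X U)"
proof -
  let ?T = "fmmr_time \<phi> S U" and ?W = "fmmr_output \<phi> S X U"
  have "set_pmf \<pi> \<inter> S \<noteq> {}"
    using stationary_distribution_pos[OF assms(1,3)] assms(6)
    by (auto simp: set_pmf_iff less_le)
  then interpret fmmr_algorithm K K' \<pi> S \<phi> P E V M X U
    using assms by unfold_locales auto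
  note joint = prob_time_output[OF assms(8)]
  \<comment> \<open>Imposing no condition on the time gives the law of the output; the same identity
    then turns the factor \<open>measure \<pi> B\<close> into a probability for the output, which
    yields independence.\<close>
  have W: "\<P>(w in M. ?W w \<in> B) = measure \<pi> B" for B
    using joint[of UNIV B] by (simp add: M.prob_space)
  have "distr M (count_space UNIV) ?W = measure_pmf \<pi>"
  proof (rule measure_eqI)
    fix B
    have "emeasure (distr M (count_space UNIV) ?W) B = emeasure M {w \<in> space M. ?W w \<in> B}"
      by (subst emeasure_distr) (auto intro!: arg_cong[where f = "emeasure M"])
    then show "emeasure (distr M (count_space UNIV) ?W) B = emeasure \<pi> B"
      by (simp add: M.emeasure_eq_measure measure_pmf.emeasure_eq_measure W)
  qed simp
  moreover have "M.indep_set (sets (vimage_algebra (space M) ?T (count_space UNIV)))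
      (sets (vimage_algebra (space M) ?W (count_space UNIV)))"
  proof (rule M.indep_setI)
    fix a b assume "a \<in> sets (vimage_algebra (space M) ?T (count_space UNIV))"
      and "b \<in> sets (vimage_algebra (space M) ?W (count_space UNIV))"
    then obtain A B where "a = {w \<in> space M. ?T w \<in> A}" and "b = {w \<in> space M. ?W w \<in> B}"
      by (auto simp: sets_vimage_algebra2 vimage_def Int_def conj_commute)
    then show "M.prob (a \<inter> b) = M.prob a * M.prob b"
      using joint[of A B] by (simp add: W Int_def conj_ac)
  qed (auto simp: sets_vimage_algebra2 intro: measurable_sets[OF measurable_time]
      measurable_sets[OF measurable_output])
  ultimately show ?thesis
    by (simp add: indep_rv_def)
qed

end
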